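(* Let $\Omega=\mathbb{R}\times\mathbb{R}^+\subset\mathbb{R}^2$, and let $\phi:\mathbb{R}\to\mathbb{R}$ be ReLU, ELU, Softplus, or LeakyReLU. Then for every $p$ with $1\le p<\infty$, $$\mathcal{S}_2(\phi)\cap L^p(\Omega)=\{0\}$$ as a subset of $L^p(\Omega)$; that is, every $F\in\mathcal{S}_2(\phi)$ with $F|_\Omega\in L^p(\Omega)$ is zero in $L^p(\Omega)$.
   Context: $\mathbb{R}^+$ is the set of positive real numbers. For a function $\phi:\mathbb{R}\to\mathbb{R}$ and an integer $m\ge1$, $\mathcal{S}_m(\phi)$ denotes the set of all functions on $\mathbb{R}^m$ of the form $x\mapsto\sum_{i=1}^k t_i\,\phi(\langle y_i,x\rangle+\varrho_i)$ with $k\in\mathbb{N}$, $t_i,\varrho_i\in\mathbb{R}$, $y_i\in\mathbb{R}^m$ (dot product $\langle\cdot,\cdot\rangle$). $L^p(\Omega)$ is with respect to Lebesgue measure. Activation functions: $\mathrm{ReLU}(x)=x$ if $x>0$ and $0$ if $x\le0$; $\mathrm{ELU}(x)=x$ if $x>0$ and $\alpha(e^x-1)$ if $x\le 0$, with $\alpha$ a real parameter; $\mathrm{Softplus}(x)=\log(e^x+1)$; $\mathrm{LeakyReLU}(x)=x$ if $x>0$ and $\alpha x$ if $x\le0$, with $\alpha$ a real parameter, $\alpha\ne1$. *)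

theory Defs
  imports "HOL-Analysis.Analysis"
begin

definition ReLU :: "real \<Rightarrow> real" where
  "ReLU x = (if x > 0 then x else 0)"

definition ELU :: "real \<Rightarrow> real \<Rightarrow> real" where
  "ELU \<alpha> x = (if x > 0 then x else \<alpha> * (exp x - 1))"

definition Softplus :: "real \<Rightarrow> real" where
  "Softplus x = ln (exp x + 1)"

definition LeakyReLU :: "real \<Rightarrow> real \<Rightarrow> real" where
  "LeakyReLU \<alpha> x = (if x > 0 then x else \<alpha> * x)"

text \<open>The dimension m of the domain is carried by the index type.\<close>

definition shallow_nets :: "(real \<Rightarrow> real) \<Rightarrow> (real ^ 'm \<Rightarrow> real) set" where
  "shallow_nets \<phi> =
     {F. \<exists>(k::nat) (t :: nat \<Rightarrow> real) (y :: nat \<Rightarrow> real ^ 'm) (\<rho> :: nat \<Rightarrow> real).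
           F = (\<lambda>x. \<Sum>i=1..k. t i * \<phi> (y i \<bullet> x + \<rho> i))}"

text \<open>Representatives of elements of Lp(\<Omega>) are total functions; since the measure is
  \<open>lebesgue_on \<Omega>\<close>, only their restrictions to \<open>\<Omega>\<close> matter.
  Elements of Lp(\<Omega>) are the classes \<open>Lp_class \<Omega> p F\<close> with \<open>F \<in> Lp_funs \<Omega> p\<close>.\<close>

definition Lp_funs :: "'a::euclidean_space set \<Rightarrow> real \<Rightarrow> ('a \<Rightarrow> real) set" where
  "Lp_funs \<Omega> p =
     {F. F \<in> borel_measurable (lebesgue_on \<Omega>) \<and>
         integrable (lebesgue_on \<Omega>) (\<lambda>x. \<bar>F x\<bar> powr p)}"

definition Lp_class ::
  "'a::euclidean_space set \<Rightarrow> real \<Rightarrow> ('a \<Rightarrow> real) \<Rightarrow> ('a \<Rightarrow> real) set" where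
  "Lp_class \<Omega> p F = {G \<in> Lp_funs \<Omega> p. AE x in lebesgue_on \<Omega>. G x = F x}"

definition upper_half_plane :: "(real ^ 2) set" where
  "upper_half_plane = {x. x $ 2 > 0}"

end

theory Submission
  imports Defs "HOL-Real_Asymp.Real_Asymp"
begin

text \<open>Each of the activation functions is asymptotic to affine functions at both ends of the real
  line, and only this is used. Let \<open>F\<close> be a network in \<open>L\<^sup>p(\<Omega>)\<close> and let \<open>v \<noteq> 0\<close> be orthogonal to one
  of its weights, with sign chosen such that \<open>\<Omega> + v \<subseteq> \<Omega>\<close>. By Fatou, \<open>F (x + n v)\<close> has \<open>0\<close> as a limit
  point for almost all \<open>x \<in> \<Omega>\<close>. Along this sequence the terms whose weight is orthogonal to \<open>v\<close> stay
  constant and all others become affine, so the former add up to an affine function almost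
  everywhere on \<open>\<Omega>\<close>. Removing terms in this way shows that \<open>F\<close> is affine, and the same argument
  gives that an affine function in \<open>L\<^sup>p(\<Omega>)\<close> vanishes.\<close>

section \<open>Decay of integrable functions along translates\<close>

text \<open>Over a half-space, the integral of the \<open>n\<close>-th translate is the integral of
  \<open>f\<close> over a receding half-space, so it tends to 0. Fatou then makes the liminf vanish
  almost everywhere there, and countably many half-spaces cover everything.\<close>

lemma AE_liminf_translates_eq_0:
  fixes f :: "'a::euclidean_space \<Rightarrow> ennreal"
  assumes f [measurable]: "f \<in> borel_measurable borel"
    and fin: "(\<integral>\<^sup>+x. f x \<partial>lborel) < \<infinity>"
    and "v \<noteq> 0"
  shows "AE x in lborel. liminf (\<lambda>n. f (x + real n *\<^sub>R v)) = 0"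
proof -
  have "AE x in lborel. - real M \<le> x \<bullet> v \<longrightarrow> liminf (\<lambda>n. f (x + real n *\<^sub>R v)) = 0" for M
  proof -
    \<comment> \<open>The cutoff is essential: over the whole space all translates have the same
      integral. \<open>?C n\<close> is \<open>?B\<close> shifted by \<open>n\<close> times
      \<open>v\<close>.\<close>
    let ?B = "{x::'a. - real M \<le> x \<bullet> v}"
    let ?C = "\<lambda>n. {x::'a. real n * (v \<bullet> v) - real M \<le> x \<bullet> v}"
    have [measurable]: "?B \<in> sets borel" "\<And>n. ?C n \<in> sets borel" by measurable
    have shift: "(\<integral>\<^sup>+x. f (x + real n *\<^sub>R v) * indicator ?B x \<partial>lborel)
        = (\<integral>\<^sup>+x. f x * indicator (?C n) x \<partial>lborel)" for n
    proof -
      have "(\<integral>\<^sup>+x. f x * indicator (?C n) x \<partial>lborel)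
          = (\<integral>\<^sup>+x. f x * indicator (?C n) x \<partial>distr lborel borel ((+) (real n *\<^sub>R v)))"
        by (simp add: lborel_distr_plus)
      also have "\<dots> = (\<integral>\<^sup>+x. f (real n *\<^sub>R v + x) * indicator (?C n) (real n *\<^sub>R v + x) \<partial>lborel)"
        by (subst nn_integral_distr) auto
      also have "\<dots> = (\<integral>\<^sup>+x. f (x + real n *\<^sub>R v) * indicator ?B x \<partial>lborel)"
        by (intro nn_integral_cong) (auto simp: indicator_def inner_add_left add.commute)
      finally show ?thesis by simp
    qed
    have "(\<lambda>n. \<integral>\<^sup>+x. f x * indicator (?C n) x \<partial>lborel) \<longlonglongrightarrow> (\<integral>\<^sup>+x. 0 \<partial>(lborel :: 'a measure))"
    proof (rule nn_integral_dominated_convergence[where w = f])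
      show "AE x in lborel. (\<lambda>n. f x * indicator (?C n) x) \<longlonglongrightarrow> 0"
      \<comment> \<open>Each point lies in only finitely many of the sets \<open>?C n\<close>, since
        \<open>v \<bullet> v\<close> is positive.\<close>
      proof (intro AE_I2 tendsto_eventually)
        fix x :: 'a
        have "0 < v \<bullet> v" using \<open>v \<noteq> 0\<close> by simp
        then have "filterlim (\<lambda>n. real n * (v \<bullet> v)) at_top sequentially" by real_asymp
        then have "\<forall>\<^sub>F n in sequentially. real n * (v \<bullet> v) > x \<bullet> v + real M"
          by (simp add: filterlim_at_top_dense)
        then show "\<forall>\<^sub>F n in sequentially. f x * indicator (?C n) x = 0"
          by eventually_elim (auto simp: indicator_def)
      qed
    qed (use fin in \<open>auto simp: indicator_def\<close>)
    then have lim0: "liminf (\<lambda>n. \<integral>\<^sup>+x. f (x + real n *\<^sub>R v) * indicator ?B x \<partial>lborel) = 0"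
      unfolding shift by (simp add: lim_imp_Liminf)
    have "(\<integral>\<^sup>+x. liminf (\<lambda>n. f (x + real n *\<^sub>R v) * indicator ?B x) \<partial>lborel) = 0"
      using nn_integral_liminf[of "\<lambda>n x. f (x + real n *\<^sub>R v) * indicator ?B x" lborel] lim0
      by simp
    then have "AE x in lborel. liminf (\<lambda>n. f (x + real n *\<^sub>R v) * indicator ?B x) = 0"
      by (subst (asm) nn_integral_0_iff_AE) auto
    then show ?thesis by eventually_elim (auto simp: indicator_def)
  qed
  then have "AE x in lborel. \<forall>M. - real M \<le> x \<bullet> v \<longrightarrow> liminf (\<lambda>n. f (x + real n *\<^sub>R v)) = 0"
    by (intro AE_all_countable[THEN iffD2] allI)
  then show ?thesis
  proof eventually_elim
    case (elim x)
    obtain M :: nat where "- (x \<bullet> v) \<le> real M" using real_arch_simple by blast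
    then have "- real M \<le> x \<bullet> v" by simp
    with elim show ?case by blast
  qed
qed

lemma translates_closed:
  fixes v :: "'a::real_vector"
  assumes "\<And>x. x \<in> \<Omega> \<Longrightarrow> x + v \<in> \<Omega>" "x \<in> \<Omega>"
  shows "x + real n *\<^sub>R v \<in> \<Omega>"
proof (induction n)
  case (Suc n)
  from assms(1)[OF this] show ?case by (simp add: scaleR_left_distrib add_ac)
qed (use assms in simp)

text \<open>Along the ray from \<open>x\<close> in direction \<open>v\<close>, \<open>F\<close> is
  asymptotically \<open>G x\<close> plus linear growth of slope \<open>d\<close>. The ray stays in
  \<open>\<Omega>\<close>, so almost surely 0 is a limit point of \<open>F\<close> along it, which
  rules out growth and any nonzero limit.\<close>

lemma AE_asymptotic_profile_eq_0:
  fixes F G :: "'a::euclidean_space \<Rightarrow> real"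
  assumes F [measurable]: "F \<in> borel_measurable borel" and \<Omega> [measurable]: "\<Omega> \<in> sets borel"
    and fin: "(\<integral>\<^sup>+x. ennreal (\<bar>F x\<bar> powr p) * indicator \<Omega> x \<partial>lborel) < \<infinity>" and "p > 0"
    and v: "v \<noteq> 0" "\<And>x. x \<in> \<Omega> \<Longrightarrow> x + v \<in> \<Omega>"
    and lim: "\<And>x. (\<lambda>n. F (x + real n *\<^sub>R v) - (G x + real n * d)) \<longlonglongrightarrow> 0"
  shows "AE x in lborel. x \<in> \<Omega> \<longrightarrow> G x = 0"
proof -
  have "AE x in lborel. liminf (\<lambda>n. ennreal (\<bar>F (x + real n *\<^sub>R v)\<bar> powr p)
      * indicator \<Omega> (x + real n *\<^sub>R v)) = 0"
    using fin v(1) by (intro AE_liminf_translates_eq_0) auto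
  then show ?thesis
  proof (eventually_elim, intro impI)
    fix x
    assume "liminf (\<lambda>n. ennreal (\<bar>F (x + real n *\<^sub>R v)\<bar> powr p)
        * indicator \<Omega> (x + real n *\<^sub>R v)) = 0" and "x \<in> \<Omega>"
    then have liminf0: "liminf (\<lambda>n. ennreal (\<bar>F (x + real n *\<^sub>R v)\<bar> powr p)) = 0"
      by (simp add: translates_closed[OF v(2) \<open>x \<in> \<Omega>\<close>])
    have Fn: "(\<lambda>n. F (x + real n *\<^sub>R v) - real n * d) \<longlonglongrightarrow> G x"
      using tendsto_add[OF lim[of x] tendsto_const[of "G x"]] by (simp add: algebra_simps)
    show "G x = 0"
    proof (cases "d = 0")
      case True
      have "(\<lambda>n. ennreal (\<bar>F (x + real n *\<^sub>R v)\<bar> powr p)) \<longlonglongrightarrow> ennreal (\<bar>G x\<bar> powr p)"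
        using Fn True \<open>p > 0\<close> by (intro tendsto_ennrealI tendsto_powr' tendsto_rabs tendsto_const) auto
      then have "ennreal (\<bar>G x\<bar> powr p) = 0"
        using liminf0 lim_imp_Liminf[OF trivial_limit_sequentially] by metis
      then show ?thesis by simp
    next
      case False
      \<comment> \<open>Nonzero slope forces the absolute values of \<open>F\<close> to infinity,
        contradicting the vanishing liminf.\<close>
      have "filterlim (\<lambda>n. real n * d) at_infinity sequentially"
        using tendsto_mult_filterlim_at_infinity[OF tendsto_const False
            tendsto_of_nat[where 'a = real]] by (simp add: mult.commute)
      from tendsto_add_filterlim_at_infinity[OF Fn this]
      have "filterlim (\<lambda>n. \<bar>F (x + real n *\<^sub>R v)\<bar>) at_top sequentially"
        by (simp add: filterlim_at_infinity_imp_norm_at_top flip: real_norm_def)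
      then have "\<forall>\<^sub>F n in sequentially. 1 \<le> \<bar>F (x + real n *\<^sub>R v)\<bar>"
        by (simp add: filterlim_at_top)
      then have "\<forall>\<^sub>F n in sequentially. 1 \<le> ennreal (\<bar>F (x + real n *\<^sub>R v)\<bar> powr p)"
        by eventually_elim (use \<open>p > 0\<close> in \<open>auto simp: ge_one_powr_ge_zero\<close>)
      then have "1 \<le> liminf (\<lambda>n. ennreal (\<bar>F (x + real n *\<^sub>R v)\<bar> powr p))"
        by (rule Liminf_bounded)
      with liminf0 show ?thesis by simp
    qed
  qed
qed

section \<open>Elimination of ridge terms\<close>

text \<open>Strong induction on the set of terms, since one step may remove several. The affine part
  \<open>c \<bullet> x + e\<close> is carried along because removed terms leave an affine function
  behind.\<close>

lemma AE_ridge_sum_eq_0: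
  fixes \<phi> :: "real \<Rightarrow> real" and y :: "'i \<Rightarrow> 'a::euclidean_space" and \<Omega> :: "'a set"
  assumes \<phi> [measurable]: "\<phi> \<in> borel_measurable borel"
    and top: "((\<lambda>r. \<phi> r - (a * r + b)) \<longlongrightarrow> 0) at_top"
    and bot: "((\<lambda>r. \<phi> r - (a' * r + b')) \<longlongrightarrow> 0) at_bot"
    and \<Omega>: "\<Omega> \<in> sets borel" and "p > 0"
    and dir: "\<And>w. \<exists>v. v \<noteq> 0 \<and> w \<bullet> v = 0 \<and> (\<forall>x\<in>\<Omega>. x + v \<in> \<Omega>)"
    and "finite S"
    and "(\<integral>\<^sup>+x. ennreal (\<bar>(\<Sum>i\<in>S. t i * \<phi> (y i \<bullet> x + \<rho> i)) + c \<bullet> x + e\<bar> powr p)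
           * indicator \<Omega> x \<partial>lborel) < \<infinity>"
  shows "AE x in lborel. x \<in> \<Omega> \<longrightarrow> (\<Sum>i\<in>S. t i * \<phi> (y i \<bullet> x + \<rho> i)) + c \<bullet> x + e = 0"
  using assms(7,8)
proof (induction S arbitrary: c e rule: finite_psubset_induct)
  case (psubset S)
  let ?h = "\<lambda>i x. t i * \<phi> (y i \<bullet> x + \<rho> i)"
  let ?F = "\<lambda>x. (\<Sum>i\<in>S. ?h i x) + c \<bullet> x + e"
  \<comment> \<open>Orthogonality to the weight of a chosen term makes that term constant along
    \<open>v\<close>, hence removable. For empty \<open>S\<close> the value 0 puts no constraint on
    \<open>v\<close>.\<close>
  define w where "w = (if S = {} then 0 else y (SOME i. i \<in> S))"
  obtain v where v: "v \<noteq> 0" "w \<bullet> v = 0" "\<And>x. x \<in> \<Omega> \<Longrightarrow> x + v \<in> \<Omega>"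
    using dir by blast
  \<comment> \<open>\<open>T\<close> holds the terms that survive the step. The sign of
    \<open>y i \<bullet> v\<close> decides which asymptote, with slope \<open>A i\<close> and
    intercept \<open>B i\<close>, such a term approaches.\<close>
  define T where "T = {i\<in>S. y i \<bullet> v \<noteq> 0}"
  have T: "T \<subseteq> S" "finite T" using \<open>finite S\<close> by (auto simp: T_def)
  define A where "A i = (if y i \<bullet> v > 0 then a else a')" for i
  define B where "B i = (if y i \<bullet> v > 0 then b else b')" for i
  define l where "l i x = t i * (A i * (y i \<bullet> x + \<rho> i) + B i)" for i x
  let ?G = "\<lambda>x. (\<Sum>i\<in>S-T. ?h i x) + (\<Sum>i\<in>T. l i x) + c \<bullet> x + e"
  let ?d = "(\<Sum>i\<in>T. t i * (A i * (y i \<bullet> v))) + c \<bullet> v"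
  have lim: "(\<lambda>n. ?F (x + real n *\<^sub>R v) - (?G x + real n * ?d)) \<longlonglongrightarrow> 0" for x
  proof -
    have term_lim: "(\<lambda>n. ?h i (x + real n *\<^sub>R v) - l i (x + real n *\<^sub>R v)) \<longlonglongrightarrow> 0" if "i \<in> T" for i
    proof -
      let ?r = "\<lambda>n::nat. y i \<bullet> (x + real n *\<^sub>R v) + \<rho> i"
      have "(\<lambda>n. \<phi> (?r n) - (A i * ?r n + B i)) \<longlonglongrightarrow> 0"
      proof (cases "y i \<bullet> v > 0")
        case True
        have "filterlim ?r at_top sequentially"
          using True unfolding inner_add_right inner_scaleR_right by real_asymp
        from filterlim_compose[OF top this] True show ?thesis by (simp add: A_def B_def)
      next
        case False
        with that have "y i \<bullet> v < 0" by (auto simp: T_def)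
        then have "filterlim ?r at_bot sequentially"
          unfolding inner_add_right inner_scaleR_right by real_asymp
        from filterlim_compose[OF bot this] False show ?thesis by (simp add: A_def B_def)
      qed
      from tendsto_mult_right_zero[OF this, of "t i"] show ?thesis
        by (simp add: l_def right_diff_distrib)
    qed
    have "?F (x + real n *\<^sub>R v) - (?G x + real n * ?d)
        = (\<Sum>i\<in>T. ?h i (x + real n *\<^sub>R v) - l i (x + real n *\<^sub>R v))" for n
    proof -
      have "?h i (x + real n *\<^sub>R v) = ?h i x" if "i \<in> S - T" for i
        using that by (simp add: T_def inner_add_right)
      then have "(\<Sum>i\<in>S. ?h i (x + real n *\<^sub>R v))
          = (\<Sum>i\<in>S-T. ?h i x) + (\<Sum>i\<in>T. ?h i (x + real n *\<^sub>R v))"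
        by (subst sum.subset_diff[OF T(1) \<open>finite S\<close>])
          (intro arg_cong2[where f = "(+)"] sum.cong refl, blast)
      moreover have "(\<Sum>i\<in>T. l i (x + real n *\<^sub>R v))
          = (\<Sum>i\<in>T. l i x) + real n * (\<Sum>i\<in>T. t i * (A i * (y i \<bullet> v)))"
        unfolding sum_distrib_left sum.distrib[symmetric]
        by (intro sum.cong) (auto simp: l_def inner_add_right algebra_simps)
      ultimately show ?thesis
        by (simp add: sum_subtractf inner_add_right algebra_simps)
    qed
    then show ?thesis using tendsto_null_sum[OF term_lim] by simp
  qed
  have G0: "AE x in lborel. x \<in> \<Omega> \<longrightarrow> ?G x = 0"
    using psubset.prems \<open>p > 0\<close> v lim
    by (intro AE_asymptotic_profile_eq_0[where F = ?F and v = v and d = ?d and p = p] \<Omega>) auto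
  show ?case
  proof (cases "S = {}")
    case True
    \<comment> \<open>Without ridge terms, \<open>?G\<close> is the affine function itself.\<close>
    with G0 T show ?thesis by simp
  next
    case False
    then have "(SOME i. i \<in> S) \<in> S - T"
      using v(2) some_in_eq[of S] by (auto simp: w_def T_def)
    with T have "T \<subset> S" by blast
    \<comment> \<open>By \<open>G0\<close>, the removed terms and the old affine part together equal
      minus the sum of the asymptotes \<open>l i\<close>; \<open>c'\<close> and \<open>e'\<close>
      are the coefficients of that function.\<close>
    define c' where "c' = - (\<Sum>i\<in>T. (t i * A i) *\<^sub>R y i)"
    define e' where "e' = - (\<Sum>i\<in>T. t i * (A i * \<rho> i + B i))"
    have l_sum: "- (\<Sum>i\<in>T. l i x) = c' \<bullet> x + e'" for x
      by (simp add: l_def c'_def e'_def inner_sum_left sum.distrib algebra_simps flip: sum_negf)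
    have F_eq: "AE x in lborel. x \<in> \<Omega> \<longrightarrow> ?F x = (\<Sum>i\<in>T. ?h i x) + c' \<bullet> x + e'"
      using G0
    proof eventually_elim
      case (elim x)
      then show ?case
        using l_sum[of x] sum.subset_diff[OF T(1) \<open>finite S\<close>, of "\<lambda>i. ?h i x"] by auto
    qed
    \<comment> \<open>Almost everywhere equality on \<open>\<Omega>\<close> passes the finiteness
      hypothesis on to the smaller sum.\<close>
    have "(\<integral>\<^sup>+x. ennreal (\<bar>(\<Sum>i\<in>T. ?h i x) + c' \<bullet> x + e'\<bar> powr p) * indicator \<Omega> x \<partial>lborel)
        = (\<integral>\<^sup>+x. ennreal (\<bar>?F x\<bar> powr p) * indicator \<Omega> x \<partial>lborel)"
      by (intro nn_integral_cong_AE, use F_eq in eventually_elim) (auto simp: indicator_def)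
    with psubset.prems psubset.IH[OF \<open>T \<subset> S\<close>, of c' e']
    have "AE x in lborel. x \<in> \<Omega> \<longrightarrow> (\<Sum>i\<in>T. ?h i x) + c' \<bullet> x + e' = 0" by simp
    with F_eq show ?thesis by eventually_elim auto
  qed
qed

section \<open>The half-plane and the activation functions\<close>

lemma upper_half_plane_borel: "upper_half_plane \<in> sets borel"
  unfolding upper_half_plane_def by (intro borel_open open_halfspace_component_gt_cart)

text \<open>A quarter turn of \<open>w\<close>, with sign chosen so that its second coordinate is
  the positive number \<open>\<bar>w $ 1\<bar>\<close>, points into the half-plane. If
  \<open>w $ 1 = 0\<close>, a horizontal vector serves.\<close>

lemma upper_half_plane_orthogonal_translation:
  fixes w :: "real ^ 2"
  shows "\<exists>v. v \<noteq> 0 \<and> w \<bullet> v = 0 \<and> (\<forall>x\<in>upper_half_plane. x + v \<in> upper_half_plane)"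
proof (cases "w $ 1 = 0")
  case True
  then have "w \<bullet> vector [1, 0] = 0" by (simp add: inner_vec_def sum_2)
  moreover have "vector [1, 0] \<noteq> (0 :: real ^ 2)" by (simp add: vec_eq_iff forall_2)
  ultimately show ?thesis
    by (intro exI[of _ "vector [1, 0]"]) (auto simp: upper_half_plane_def)
next
  case False
  let ?v = "sgn (w $ 1) *\<^sub>R vector [- w $ 2, w $ 1] :: real ^ 2"
  have "w \<bullet> ?v = 0" by (simp add: inner_vec_def sum_2)
  moreover have "?v $ 2 > 0" using False by (simp add: sgn_if)
  moreover from this have "?v \<noteq> 0" by (metis less_irrefl zero_index)
  ultimately show ?thesis
    by (intro exI[of _ ?v]) (simp add: upper_half_plane_def add_pos_pos del: vector_scaleR_component)
qed

text \<open>All four approach the identity at the right end. At the left end the asymptotes are 0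
  for ReLU and Softplus, \<open>- \<alpha>\<close> for ELU and \<open>\<alpha> * r\<close> for
  LeakyReLU.\<close>

lemma activation_affine_asymptotes:
  assumes "\<phi> = ReLU \<or> (\<exists>\<alpha>. \<phi> = ELU \<alpha>) \<or> \<phi> = Softplus \<or> (\<exists>\<alpha>. \<phi> = LeakyReLU \<alpha>)"
  shows "\<phi> \<in> borel_measurable borel"
    and "((\<lambda>r. \<phi> r - (1 * r + 0)) \<longlongrightarrow> 0) at_top"
    and "\<exists>a b. ((\<lambda>r. \<phi> r - (a * r + b)) \<longlongrightarrow> 0) at_bot"
proof -
  show "\<phi> \<in> borel_measurable borel"
    using assms unfolding ReLU_def[abs_def] ELU_def[abs_def] Softplus_def[abs_def] LeakyReLU_def[abs_def]
    by (elim disjE exE) simp_all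
  have pos: "\<forall>\<^sub>F r in at_top. (0::real) < r" by (rule eventually_gt_at_top)
  have neg: "\<forall>\<^sub>F r in at_bot. r < (0::real)" by (auto simp: eventually_at_bot_dense)
  consider "\<phi> = ReLU" | \<alpha> where "\<phi> = ELU \<alpha>" | "\<phi> = Softplus" | \<alpha> where "\<phi> = LeakyReLU \<alpha>"
    using assms by blast
  note activation_cases = this
  from activation_cases show "((\<lambda>r. \<phi> r - (1 * r + 0)) \<longlongrightarrow> 0) at_top"
  proof cases
    case 3
    then show ?thesis unfolding 3 Softplus_def[abs_def] by real_asymp
  qed (intro tendsto_eventually, use pos in \<open>eventually_elim, simp add: ReLU_def ELU_def LeakyReLU_def\<close>)+
  from activation_cases show "\<exists>a b. ((\<lambda>r. \<phi> r - (a * r + b)) \<longlongrightarrow> 0) at_bot"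
  proof cases
    case 1
    have "((\<lambda>r. \<phi> r - (0 * r + 0)) \<longlongrightarrow> 0) at_bot"
      by (intro tendsto_eventually, use neg in eventually_elim) (simp add: 1 ReLU_def)
    then show ?thesis by blast
  next
    case (2 \<alpha>)
    have "((\<lambda>r::real. \<alpha> * exp r) \<longlongrightarrow> 0) at_bot"
      by (intro tendsto_mult_right_zero exp_at_bot)
    moreover have "\<forall>\<^sub>F r in at_bot. \<alpha> * exp r = \<phi> r - (0 * r + (- \<alpha>))"
      using neg by eventually_elim (simp add: 2 ELU_def algebra_simps)
    ultimately have "((\<lambda>r. \<phi> r - (0 * r + (- \<alpha>))) \<longlongrightarrow> 0) at_bot"
      by (rule Lim_transform_eventually)
    then show ?thesis by blast
  next
    case 3
    have "((\<lambda>r. \<phi> r - (0 * r + 0)) \<longlongrightarrow> 0) at_bot"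
      unfolding 3 Softplus_def[abs_def] by real_asymp
    then show ?thesis by blast
  next
    case (4 \<alpha>)
    have "((\<lambda>r. \<phi> r - (\<alpha> * r + 0)) \<longlongrightarrow> 0) at_bot"
      by (intro tendsto_eventually, use neg in eventually_elim) (simp add: 4 LeakyReLU_def)
    then show ?thesis by blast
  qed
qed

section \<open>Passage to classes in Lp\<close>

text \<open>Integrals against Lebesgue measure and its Borel restriction \<open>lborel\<close>
  agree, which gives access to the translation argument.\<close>

lemma Lp_funs_nn_integral_finite:
  assumes "F \<in> Lp_funs \<Omega> p" and \<Omega>: "\<Omega> \<in> sets borel"
  shows "(\<integral>\<^sup>+x. ennreal (\<bar>F x\<bar> powr p) * indicator \<Omega> x \<partial>lborel) < \<infinity>"
proof -
  have "integrable (lebesgue_on \<Omega>) (\<lambda>x. \<bar>F x\<bar> powr p)"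
    using assms by (simp add: Lp_funs_def)
  then have "(\<integral>\<^sup>+x. ennreal (\<bar>F x\<bar> powr p) \<partial>lebesgue_on \<Omega>) < \<infinity>"
    by (simp add: integrable_iff_bounded)
  then show ?thesis
    using \<Omega> by (simp add: nn_integral_restrict_space nn_integral_completion)
qed

lemma Lp_class_cong_AE:
  assumes "AE x in lebesgue_on \<Omega>. F x = G x"
  shows "Lp_class \<Omega> p F = Lp_class \<Omega> p G"
proof -
  have "(AE x in lebesgue_on \<Omega>. H x = F x) \<longleftrightarrow> (AE x in lebesgue_on \<Omega>. H x = G x)" for H
    by (intro eventually_subst, use assms in eventually_elim) simp
  then show ?thesis by (simp add: Lp_class_def)
qed

theorem proposition4p6:
  fixes \<phi> :: "real \<Rightarrow> real" and p :: real
  assumes "\<phi> = ReLU \<or> (\<exists>\<alpha>. \<phi> = ELU \<alpha>) \<or> \<phi> = Softplus \<or> (\<exists>\<alpha>. \<alpha> \<noteq> 1 \<and> \<phi> = LeakyReLU \<alpha>)"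
    and "1 \<le> p"
  shows "Lp_class upper_half_plane p ` (shallow_nets \<phi> \<inter> Lp_funs upper_half_plane p) =
         {Lp_class upper_half_plane p (\<lambda>_. 0)}"
proof -
  have "\<phi> = ReLU \<or> (\<exists>\<alpha>. \<phi> = ELU \<alpha>) \<or> \<phi> = Softplus \<or> (\<exists>\<alpha>. \<phi> = LeakyReLU \<alpha>)"
    using assms(1) by blast
  note asymptotes = activation_affine_asymptotes[OF this]
  obtain a b where bot: "((\<lambda>r. \<phi> r - (a * r + b)) \<longlongrightarrow> 0) at_bot"
    using asymptotes(3) by blast
  have "Lp_class upper_half_plane p F = Lp_class upper_half_plane p (\<lambda>_. 0)"
    if F: "F \<in> shallow_nets \<phi>" "F \<in> Lp_funs upper_half_plane p" for F
  proof -
    from F(1) obtain k :: nat and t :: "nat \<Rightarrow> real" and y :: "nat \<Rightarrow> real ^ 2" and \<rho> :: "nat \<Rightarrow> real"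
      where F_eq: "F = (\<lambda>x. \<Sum>i=1..k. t i * \<phi> (y i \<bullet> x + \<rho> i))"
      unfolding shallow_nets_def by blast
    \<comment> \<open>The elimination starts with zero affine part.\<close>
    have "AE x in lborel. x \<in> upper_half_plane \<longrightarrow>
        (\<Sum>i=1..k. t i * \<phi> (y i \<bullet> x + \<rho> i)) + 0 \<bullet> x + 0 = 0"
      using Lp_funs_nn_integral_finite[OF F(2) upper_half_plane_borel] \<open>1 \<le> p\<close>
      by (intro AE_ridge_sum_eq_0[OF asymptotes(1,2) bot upper_half_plane_borel _
            upper_half_plane_orthogonal_translation, where p = p]) (simp_all add: F_eq)
    then have "AE x in lebesgue_on upper_half_plane. F x = 0"
      using upper_half_plane_borel by (simp add: AE_restrict_space_iff AE_completion_iff F_eq)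
    then show ?thesis by (rule Lp_class_cong_AE)
  qed
  \<comment> \<open>The empty network, \<open>k = 0\<close>, shows that the zero class is
    attained.\<close>
  moreover have "(\<lambda>_. 0) \<in> shallow_nets \<phi> \<inter> Lp_funs upper_half_plane p"
    by (auto simp: shallow_nets_def Lp_funs_def intro!: exI[of _ "0::nat"])
  ultimately show ?thesis by blast
qed

end
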